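(* Let $k$ be a positive integer. Let $K_1, K_2, \dots, K_k$ be distinct imaginary quadratic fields other than $\mathbb{Q}(\sqrt{-1})$. Then there exists a positive integer $n$ such that $I_{2n}^{2,i}$ contains a primitive element (over $\mathbb{Q}$) of every $K_i$, $i \in \{1,2,\dots,k\}$.
   Context: An imaginary quadratic field is a subfield of $\mathbb{C}$ of degree two over $\mathbb{Q}$ not contained in $\mathbb{R}$. For a positive integer $c$, $\sqrt{-c}$ denotes $\sqrt{c}\,\sqrt{-1}$. For an even integer $n \ge 2$, $$I_n^{2,i} := \left\{\sqrt{-c} \in \mathbb{C}\setminus\mathbb{R} \;\middle|\; c \in \mathbb{Z},\ \left(\tfrac{n}{2}\right)^2 < c < \left(\tfrac{n}{2}+1\right)^2\right\}.$$ *)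

theory Defs
  imports Complex_Main "HOL-Algebra.Generated_Fields" "HOL-Algebra.Algebraic_Closure_Type"
begin

abbreviation complex_ring :: "complex ring" where
  "complex_ring \<equiv> ring_of_type_algebra"

(* The inductive predicate ring.dimension determines the dimension exactly, so
   ring.dimension complex_ring 2 \<rat> K says [K : \<rat>] = 2. *)
definition imaginary_quadratic_field :: "complex set \<Rightarrow> bool" where
  "imaginary_quadratic_field K \<longleftrightarrow>
     subfield K complex_ring \<and> ring.dimension complex_ring 2 \<rat> K \<and> \<not> K \<subseteq> \<real>"

definition rat_adjoin :: "complex \<Rightarrow> complex set" where
  "rat_adjoin \<alpha> = generate_field complex_ring (\<rat> \<union> {\<alpha>})"

definition primitive_element :: "complex \<Rightarrow> complex set \<Rightarrow> bool" where
  "primitive_element \<alpha> K \<longleftrightarrow> \<alpha> \<in> K \<and> rat_adjoin \<alpha> = K"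

(* sqrt_neg c is the square root of -c, for c > 0. *)
definition sqrt_neg :: "int \<Rightarrow> complex" where
  "sqrt_neg c = complex_of_real (sqrt (of_int c)) * \<i>"

(* The set I_n^{2,i}; the superscript i is part of the name, not an index.
   Meant for even n \<ge> 2; the bounds force c > 0. *)
definition I2i :: "nat \<Rightarrow> complex set" where
  "I2i n = {sqrt_neg c | c :: int. sqrt_neg c \<notin> \<real> \<and>
     (real n / 2)\<^sup>2 < of_int c \<and> of_int c < (real n / 2 + 1)\<^sup>2}"

end

theory Submission
  imports Defs "HOL-Analysis.Kronecker_Approximation_Theorem"
begin

text \<open>
  Each field is generated by the square root of \<open>-d\<close> for a squarefree \<open>d > 1\<close>, where \<open>d = 1\<close> is
  excluded because the Gaussian field is. The multiple \<open>m * sqrt (-d)\<close> lies in the set of index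
  \<open>2 * n\<close> iff \<open>n < m * sqrt d < n + 1\<close>, and such an \<open>m\<close> exists iff \<open>n / sqrt d\<close> lies less than
  \<open>1 / sqrt d\<close> below an integer. The numbers \<open>1 / sqrt d\<close> for the different \<open>d\<close> are linearly
  independent over the rationals together with 1, so Kronecker's theorem provides an integer \<open>n\<close>
  that works for all \<open>d\<close> at once.
\<close>

section \<open>Square roots of squarefree numbers\<close>

text \<open>A subfield of the reals as a plain set. Closure under \<open>inverse\<close> can be
  required of every element because \<open>inverse 0 = 0\<close>.\<close>

definition real_subfield :: "real set \<Rightarrow> bool" where
  "real_subfield F \<longleftrightarrow> \<rat> \<subseteq> F \<and> (\<forall>x\<in>F. \<forall>y\<in>F. x + y \<in> F \<and> x * y \<in> F) \<and>
     (\<forall>x\<in>F. - x \<in> F \<and> inverse x \<in> F)"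

lemma real_subfieldD:
  assumes "real_subfield F"
  shows "x \<in> \<rat> \<Longrightarrow> x \<in> F"
    and "x \<in> F \<Longrightarrow> y \<in> F \<Longrightarrow> x + y \<in> F"
    and "x \<in> F \<Longrightarrow> y \<in> F \<Longrightarrow> x * y \<in> F"
    and "x \<in> F \<Longrightarrow> - x \<in> F"
    and "x \<in> F \<Longrightarrow> inverse x \<in> F"
    and "x \<in> F \<Longrightarrow> y \<in> F \<Longrightarrow> x - y \<in> F"
    and "x \<in> F \<Longrightarrow> y \<in> F \<Longrightarrow> x / y \<in> F"
proof -
  show *: "x \<in> \<rat> \<Longrightarrow> x \<in> F" "x \<in> F \<Longrightarrow> y \<in> F \<Longrightarrow> x + y \<in> F"
    "x \<in> F \<Longrightarrow> y \<in> F \<Longrightarrow> x * y \<in> F" "x \<in> F \<Longrightarrow> - x \<in> F" "x \<in> F \<Longrightarrow> inverse x \<in> F" for x y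
    using assms unfolding real_subfield_def by blast+
  show "x \<in> F \<Longrightarrow> y \<in> F \<Longrightarrow> x - y \<in> F"
    using *(2)[of x "- y"] *(4)[of y] by simp
  show "x \<in> F \<Longrightarrow> y \<in> F \<Longrightarrow> x / y \<in> F"
    using *(3)[of x "inverse y"] *(5)[of y] by (simp add: divide_inverse)
qed

lemma real_subfield_sum:
  assumes "real_subfield F" "\<And>i. i \<in> A \<Longrightarrow> f i \<in> F"
  shows "sum f A \<in> F"
  using assms(2)
  by (induction A rule: infinite_finite_induct) (auto intro: real_subfieldD[OF assms(1)])

lemma real_subfield_Rats: "real_subfield \<rat>"
  unfolding real_subfield_def by auto

text \<open>Inverses come from rationalising the denominator with the conjugate
  \<open>a - b * s\<close>; as \<open>s\<close> lies outside \<open>F\<close>, the norm vanishes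
  only at 0.\<close>

lemma real_subfield_adjoin_sqrt:
  assumes F: "real_subfield F" and r: "r \<in> F" and s: "s * s = r" "s \<notin> F"
  shows "real_subfield {a + b * s | a b. a \<in> F \<and> b \<in> F}" (is "real_subfield ?E")
  unfolding real_subfield_def
proof (intro conjI ballI subsetI)
  note FD = real_subfieldD[OF F]
  fix x :: real assume "x \<in> \<rat>"
  then have "x \<in> F" "0 \<in> F" "x = x + 0 * s"
    by (auto intro: FD(1))
  then show "x \<in> ?E" by blast
next
  note FD = real_subfieldD[OF F]
  fix x y assume "x \<in> ?E" "y \<in> ?E"
  then obtain a b c d where ab: "a \<in> F" "b \<in> F" "x = a + b * s"
    and cd: "c \<in> F" "d \<in> F" "y = c + d * s" by blast
  have "x + y = (a + c) + (b + d) * s"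
    by (simp add: ab cd algebra_simps)
  then show "x + y \<in> ?E"
    using FD(2) ab cd by blast
  have "x * y = (a * c + b * d * r) + (a * d + b * c) * s"
    by (simp add: ab cd algebra_simps flip: s(1))
  moreover have "a * c + b * d * r \<in> F" "a * d + b * c \<in> F"
    by (intro FD(2,3) ab cd r)+
  ultimately show "x * y \<in> ?E"
    by blast
next
  note FD = real_subfieldD[OF F]
  fix x assume "x \<in> ?E"
  then obtain a b where ab: "a \<in> F" "b \<in> F" "x = a + b * s" by blast
  have "- x = - a + (- b) * s" by (simp add: ab)
  then show "- x \<in> ?E"
    using FD(4) ab by blast
  \<comment> \<open>The norm of \<open>x\<close>, the product of \<open>x\<close> and its
    conjugate.\<close>
  define N where "N = a * a - b * b * r"
  have N: "N \<in> F" unfolding N_def by (intro FD(6,3) ab r)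
  have eq: "x * (a - b * s) = N"
    by (simp add: N_def ab algebra_simps flip: s(1))
  have "inverse x = a / N + (- b / N) * s"
  proof (cases "N = 0")
    case True
    \<comment> \<open>Otherwise \<open>s\<close> would be \<open>a / b\<close> up to sign and hence
      in \<open>F\<close>. With \<open>b = 0\<close> also \<open>a = 0\<close>, and the claimed
      equation holds because inverting or dividing by 0 gives 0.\<close>
    have "b = 0"
    proof (rule ccontr)
      assume b: "b \<noteq> 0"
      have "a = - b * s \<or> a = b * s"
        using eq True ab(3) by (auto simp: eq_neg_iff_add_eq_0)
      then have "s = - (a / b) \<or> s = a / b"
        using b by (auto simp: field_simps)
      then show False
        using s(2) FD(4,7) ab by metis
    qed
    then show ?thesis
      using True by (simp add: N_def ab)
  next
    case False
    then have "x \<noteq> 0" using eq by auto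
    then show ?thesis
      using False eq by (simp add: field_simps)
  qed
  moreover have "a / N \<in> F" "- b / N \<in> F"
    by (intro FD(7,4) ab N)+
  ultimately show "inverse x \<in> ?E"
    by blast
qed

lemma sqrt_squarefree_irrational:
  fixes d :: nat
  assumes "squarefree d" "d \<noteq> 1"
  shows "sqrt (real d) \<notin> \<rat>"
proof
  assume "sqrt (real d) \<in> \<rat>"
  then obtain m n :: nat where mn: "n \<noteq> 0" "\<bar>sqrt (real d)\<bar> = real m / real n" "coprime m n"
    by (rule Rats_abs_nat_div_natE)
  then have "sqrt (real d) * real n = real m"
    by (simp add: field_simps)
  then have "(sqrt (real d) * real n)\<^sup>2 = (real m)\<^sup>2"
    by simp
  then have "real (d * n\<^sup>2) = real (m\<^sup>2)"
    by (simp add: power_mult_distrib)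
  then have eq: "d * n\<^sup>2 = m\<^sup>2"
    by (simp only: of_nat_eq_iff)
  then have "n\<^sup>2 dvd m\<^sup>2"
    by (metis dvd_triv_right)
  then have "n dvd m" by simp
  then have "n = 1"
    using mn(3) by (metis coprime_absorb_right nat_dvd_1_iff_1)
  then have "d = m\<^sup>2"
    using eq by simp
  then show False
    using assms squarefreeD[of d m] by auto
qed

text \<open>Adjoins the roots of the primes in \<open>P\<close> one at a time. Excluding the roots
  of all squarefree \<open>d\<close> prime to \<open>P\<close>, not only of primes, makes the
  induction work: it has to be applied both to the next prime \<open>q\<close> and to
  \<open>d * q\<close>.\<close>

lemma ex_real_subfield_primes:
  fixes P :: "nat set"
  assumes "finite P" "\<And>p. p \<in> P \<Longrightarrow> prime p"
  shows "\<exists>F. real_subfield F \<and> (\<forall>p\<in>P. sqrt (real p) \<in> F) \<and>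
    (\<forall>d::nat. squarefree d \<longrightarrow> d \<noteq> 1 \<longrightarrow> (\<forall>p\<in>P. \<not> p dvd d) \<longrightarrow> sqrt (real d) \<notin> F)"
  using assms
proof (induction P)
  case empty
  then show ?case
    using real_subfield_Rats sqrt_squarefree_irrational by blast
next
  case (insert q P)
  then obtain F where F: "real_subfield F" "\<And>p. p \<in> P \<Longrightarrow> sqrt (real p) \<in> F"
    and F': "\<And>d::nat. squarefree d \<Longrightarrow> d \<noteq> 1 \<Longrightarrow> (\<And>p. p \<in> P \<Longrightarrow> \<not> p dvd d) \<Longrightarrow> sqrt (real d) \<notin> F"
    by auto
  note FD = real_subfieldD[OF F(1)]
  define s where "s = sqrt (real q)"
  have q: "prime q" using insert.prems by simp
  have not_dvd_q: "\<not> p dvd q" if "p \<in> P" for p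
    using that insert.hyps(2) insert.prems q by (metis insertCI primes_dvd_imp_eq)
  have s: "s \<notin> F" "s * s = real q"
    unfolding s_def using F'[of q] q not_dvd_q prime_gt_1_nat[OF q] by (auto simp: squarefree_prime)
  let ?E = "{a + b * s | a b. a \<in> F \<and> b \<in> F}"
  have "real_subfield ?E"
    using s by (intro real_subfield_adjoin_sqrt[of _ "real q"] F) (auto intro: FD(1))
  moreover have "sqrt (real p) \<in> ?E" if p: "p \<in> insert q P" for p
  proof (cases "p = q")
    case True
    have "s = 0 + 1 * s" "0 \<in> F" "1 \<in> F" by (auto intro: FD(1))
    then have "s \<in> ?E" by blast
    then show ?thesis by (simp add: True s_def)
  next
    case False
    then have "sqrt (real p) \<in> F" using F(2) p by blast
    moreover have "sqrt (real p) = sqrt (real p) + 0 * s" "0 \<in> F" by (auto intro: FD(1))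
    ultimately show ?thesis by blast
  qed
  moreover have "sqrt (real d) \<notin> ?E"
    if d: "squarefree d" "d \<noteq> 1" "\<And>p. p \<in> insert q P \<Longrightarrow> \<not> p dvd d" for d :: nat
  proof
    assume "sqrt (real d) \<in> ?E"
    then obtain a b where ab: "a \<in> F" "b \<in> F" "sqrt (real d) = a + b * s" by blast
    have "real d = (a + b * s)\<^sup>2"
      using ab(3) by (metis of_nat_0_le_iff real_sqrt_pow2)
    \<comment> \<open>Squaring \<open>a + b * s\<close> isolates \<open>s\<close>, so
      \<open>s\<close> would lie in \<open>F\<close> unless \<open>a\<close> or \<open>b\<close>
      vanishes.\<close>
    then have eq: "2 * a * b * s = real d - a * a - b * b * real q"
      by (simp add: power2_eq_square algebra_simps flip: s(2))
    consider "b = 0" | "a = 0" | "a * b \<noteq> 0" by force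
    then show False
    proof cases
      case 1
      then show False using ab F'[of d] d by auto
    next
      case 2
      \<comment> \<open>Now \<open>sqrt d = b * s\<close>, and multiplying by \<open>s\<close> puts
        the root of \<open>d * q\<close> into \<open>F\<close>; but \<open>d * q\<close> is again
        squarefree and prime to \<open>P\<close>.\<close>
      have "coprime d q"
        using d(3)[of q] q by (metis coprime_commute insertI1 prime_imp_coprime)
      then have "squarefree (d * q)"
        using d(1) q by (simp add: squarefree_mult_coprime squarefree_prime)
      moreover have "\<not> p dvd d * q" if p: "p \<in> P" for p
        using p d(3)[of p] not_dvd_q[of p] insert.prems[of p]
        by (simp add: prime_dvd_mult_iff)
      moreover have "d * q \<noteq> 1" using d by simp
      ultimately have "sqrt (real (d * q)) \<notin> F"
        by (intro F')
      moreover have "sqrt (real (d * q)) = b * real q"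
        using 2 ab(3) s(2) by (simp add: real_sqrt_mult s_def)
      ultimately show False
        using ab(2) FD(3)[of b "real q"] FD(1)[of "real q"] by simp
    next
      case 3
      then have "s = (real d - a * a - b * b * real q) / (2 * a * b)"
        unfolding eq[symmetric] by simp
      moreover have "real d \<in> F" "real q \<in> F" "2 \<in> F" by (auto intro: FD(1))
      then have "(real d - a * a - b * b * real q) / (2 * a * b) \<in> F"
        by (intro FD(7,6,3) ab)
      ultimately show False using s(1) by simp
    qed
  qed
  ultimately show ?case by blast
qed

section \<open>Linear independence of square roots over the rationals\<close>

lemma sqrt_mem_real_subfield:
  fixes d :: nat
  assumes "real_subfield F" "\<And>p. p \<in> prime_factors d \<Longrightarrow> sqrt (real p) \<in> F"
  shows "sqrt (real d) \<in> F"
proof (cases "d = 0")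
  case True
  then show ?thesis by (auto intro: real_subfieldD(1)[OF assms(1)])
next
  case False
  have "\<forall>p\<in>#A. sqrt (real p) \<in> F \<Longrightarrow> sqrt (real (prod_mset A)) \<in> F" for A :: "nat multiset"
    by (induction A) (auto simp: real_sqrt_mult intro: real_subfieldD[OF assms(1)])
  from this[of "prime_factorization d"] show ?thesis
    using assms(2) False by (simp add: prod_mset_prime_factorization_nat)
qed

text \<open>Sorting the terms by divisibility by a new prime \<open>q\<close> turns the relation
  into \<open>x + sqrt q * y = 0\<close> with \<open>x\<close> and \<open>y\<close> in a field not
  containing \<open>sqrt q\<close>. Both parts vanish, and the induction hypothesis applies to
  each.\<close>

lemma sqrt_squarefree_independent_primes:
  fixes P D :: "nat set" and a :: "nat \<Rightarrow> real"
  assumes "finite P" "\<And>p. p \<in> P \<Longrightarrow> prime p"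
    and "finite D" "\<And>d. d \<in> D \<Longrightarrow> squarefree d \<and> prime_factors d \<subseteq> P"
    and "\<And>d. d \<in> D \<Longrightarrow> a d \<in> \<rat>" and "(\<Sum>d\<in>D. a d * sqrt (real d)) = 0"
  shows "\<forall>d\<in>D. a d = 0"
  using assms
proof (induction P arbitrary: D a)
  case empty
  \<comment> \<open>The number 0 has no prime factors either, but it is not squarefree.\<close>
  have "d = 1" if "d \<in> D" for d
    using empty.prems(3)[OF that] by (auto simp: prime_factorization_empty_iff)
  then have "D \<subseteq> {1}" by blast
  then have "D = {} \<or> D = {1}" by blast
  then show ?case
    using empty.prems(5) by auto
next
  case (insert q P)
  have q: "prime q" using insert.prems by simp
  then have q0: "q > 0" by (simp add: prime_gt_0_nat)
  obtain F where F: "real_subfield F" "\<And>p. p \<in> P \<Longrightarrow> sqrt (real p) \<in> F"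
    and F': "\<And>d::nat. squarefree d \<Longrightarrow> d \<noteq> 1 \<Longrightarrow> (\<And>p. p \<in> P \<Longrightarrow> \<not> p dvd d) \<Longrightarrow> sqrt (real d) \<notin> F"
    using ex_real_subfield_primes[of P] insert by auto
  note FD = real_subfieldD[OF F(1)]
  have sq: "sqrt (real q) \<notin> F"
  proof (rule F')
    show "\<not> p dvd q" if "p \<in> P" for p
      using that insert.hyps(2) insert.prems(1) q by (metis insertCI primes_dvd_imp_eq)
  qed (use q prime_gt_1_nat[OF q] in \<open>auto simp: squarefree_prime\<close>)
  \<comment> \<open>\<open>A\<close> collects the indices prime to \<open>q\<close>, and
    \<open>B\<close> the cofactors of the others.\<close>
  define A where "A = {d \<in> D. \<not> q dvd d}"
  define B where "B = {e. q * e \<in> D}"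
  have D: "D = A \<union> (*) q ` B" "A \<inter> (*) q ` B = {}"
    by (auto simp: A_def B_def)
  have inj: "inj_on ((*) q) B"
    using q0 by (auto simp: inj_on_def)
  have fin: "finite A" "finite B"
    using insert.prems(2) inj finite_imageD[of "(*) q" B] D(1) by auto
  have A: "squarefree d \<and> prime_factors d \<subseteq> P" "a d \<in> \<rat>" if "d \<in> A" for d
    using that insert.prems(3,4)[of d] by (auto simp: A_def)
  have B: "squarefree e \<and> prime_factors e \<subseteq> P" "a (q * e) \<in> \<rat>" if e: "e \<in> B" for e
  proof -
    have qe: "squarefree (q * e)" "prime_factors (q * e) \<subseteq> insert q P" "a (q * e) \<in> \<rat>"
      using e insert.prems(3,4)[of "q * e"] by (auto simp: B_def)
    then have "e \<noteq> 0" by (metis mult_0_right not_squarefree_0)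
    \<comment> \<open>This removes \<open>q\<close> from the prime factors of \<open>e\<close>,
      which therefore lie in \<open>P\<close>.\<close>
    have "\<not> q dvd e"
    proof
      assume "q dvd e"
      then have "q\<^sup>2 dvd q * e" by (simp add: power2_eq_square)
      then have "q dvd 1" using squarefreeD[OF qe(1)] by blast
      then show False using q by (metis not_prime_unit)
    qed
    then show "squarefree e \<and> prime_factors e \<subseteq> P"
      using qe \<open>e \<noteq> 0\<close> q0 squarefree_multD(2)[OF qe(1)]
      by (auto simp: prime_factorization_mult)
    show "a (q * e) \<in> \<rat>" by fact
  qed
  define x where "x = (\<Sum>d\<in>A. a d * sqrt (real d))"
  define y where "y = (\<Sum>e\<in>B. a (q * e) * sqrt (real e))"
  have "(\<Sum>d\<in>D. a d * sqrt (real d)) = x + (\<Sum>d\<in>(*) q ` B. a d * sqrt (real d))"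
    unfolding x_def using D fin by (simp add: sum.union_disjoint)
  also have "(\<Sum>d\<in>(*) q ` B. a d * sqrt (real d)) = sqrt (real q) * y"
    unfolding y_def sum.reindex[OF inj] by (simp add: sum_distrib_left real_sqrt_mult mult_ac)
  finally have xy: "x + sqrt (real q) * y = 0"
    using insert.prems(5) by simp
  have mem: "(\<Sum>e\<in>C. b e * sqrt (real e)) \<in> F"
    if "\<And>e. e \<in> C \<Longrightarrow> prime_factors e \<subseteq> P" "\<And>e. e \<in> C \<Longrightarrow> b e \<in> \<rat>" for C :: "nat set" and b
  proof (intro real_subfield_sum[OF F(1)] FD(3))
    fix e assume e: "e \<in> C"
    show "b e \<in> F" using that(2)[OF e] by (rule FD(1))
    show "sqrt (real e) \<in> F"
      by (rule sqrt_mem_real_subfield[OF F(1)]) (use that(1)[OF e] F(2) in blast)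
  qed
  have x: "x \<in> F" unfolding x_def by (rule mem) (use A in auto)
  have y: "y \<in> F" unfolding y_def by (rule mem) (use B in auto)
  have "y = 0"
  proof (rule ccontr)
    assume "y \<noteq> 0"
    then have "sqrt (real q) = (- x) / y" using xy by (simp add: field_simps)
    then show False using sq FD(4,7) x y by metis
  qed
  then have "x = 0" using xy by simp
  have "\<forall>d\<in>A. a d = 0"
    by (rule insert.IH) (use insert.prems(1) A fin \<open>x = 0\<close> in \<open>auto simp: x_def\<close>)
  moreover have "\<forall>e\<in>B. a (q * e) = 0"
    by (rule insert.IH) (use insert.prems(1) B fin \<open>y = 0\<close> in \<open>auto simp: y_def\<close>)
  ultimately show ?case
    using D(1) by auto
qed

lemma sqrt_squarefree_independent:
  fixes D :: "nat set" and a :: "nat \<Rightarrow> real"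
  assumes "finite D" "\<And>d. d \<in> D \<Longrightarrow> squarefree d"
    and "\<And>d. d \<in> D \<Longrightarrow> a d \<in> \<rat>" and "(\<Sum>d\<in>D. a d * sqrt (real d)) = 0"
    and "d \<in> D"
  shows "a d = 0"
proof -
  have "\<forall>d\<in>D. a d = 0"
    using assms
    by (intro sqrt_squarefree_independent_primes[of "\<Union>d\<in>D. prime_factors d"]) auto
  then show ?thesis using assms by blast
qed

section \<open>Simultaneous approximation\<close>

text \<open>Since \<open>1 / sqrt d = sqrt d / d\<close>, an integer relation between the inverse
  roots is a rational relation between the roots. Independence is over the integers, as Kronecker's
  theorem expects.\<close>

lemma independent_inverse_sqrt:
  fixes D :: "nat set"
  assumes "\<And>d. d \<in> D \<Longrightarrow> squarefree d"
  shows "module.independent (\<lambda>r x. of_int r * x) ((\<lambda>d. 1 / sqrt (real d)) ` D)"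
proof -
  interpret Modules.module "\<lambda>r. (*) (real_of_int r)"
    by (simp add: Modules.module.intro distrib_left mult.commute)
  let ?f = "\<lambda>d. 1 / sqrt (real d)"
  show ?thesis
    unfolding dependent_explicit
  proof clarify
    fix T :: "real set" and u v
    assume T: "finite T" "T \<subseteq> ?f ` D" and sum: "(\<Sum>v\<in>T. of_int (u v) * v) = 0"
      and v: "v \<in> T" "u v \<noteq> 0"
    \<comment> \<open>One preimage for each element of \<open>T\<close>, so that the sum over
      \<open>T\<close> can be reindexed.\<close>
    obtain E where E: "E \<subseteq> D" "inj_on ?f E" "T = ?f ` E"
      using T(2) by (metis subset_image_inj)
    have pos: "d > 0" if "d \<in> E" for d
      using that assms E(1) by (metis gr0I not_squarefree_0 subsetD)
    have "(\<Sum>d\<in>E. of_int (u (?f d)) / real d * sqrt (real d)) = (\<Sum>v\<in>T. of_int (u v) * v)"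
      unfolding E(3) sum.reindex[OF E(2)]
      using pos by (intro sum.cong) (auto simp: field_simps)
    moreover have "finite E" using T(1) E by (simp add: finite_image_iff)
    moreover obtain d where d: "d \<in> E" "v = ?f d" using v E by blast
    ultimately have "of_int (u (?f d)) / real d = 0"
      using sum E(1) assms
      by (intro sqrt_squarefree_independent[of E "\<lambda>d. of_int (u (?f d)) / real d"]) auto
    then show False using d v pos by auto
  qed
qed

text \<open>With \<open>\<theta> = 1 / sqrt d\<close>, the goal is an integer \<open>m\<close>
  strictly between \<open>k * \<theta>\<close> and \<open>(k + 1) * \<theta>\<close>. Kronecker's
  theorem finds one \<open>k\<close> for all \<open>d\<close> by bringing each
  \<open>k * \<theta> + \<theta> / 2\<close> close to an integer.\<close>

lemma ex_common_floor_multiple_sqrt: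
  fixes D :: "nat set"
  assumes "finite D" "D \<noteq> {}" and D: "\<And>d. d \<in> D \<Longrightarrow> squarefree d \<and> d > 1"
  shows "\<exists>k::int. \<forall>d\<in>D. \<exists>m::int. k < m * sqrt (real d) \<and> m * sqrt (real d) < real_of_int k + 1"
proof -
  define N where "N = card D"
  obtain g where g: "bij_betw g {..<N} D"
    using ex_bij_betw_nat_finite[OF assms(1)] by (auto simp: N_def atLeast0LessThan)
  \<comment> \<open>The extra index \<open>N\<close> yields \<open>\<theta> N = 1\<close>, the last
    entry in Kronecker's theorem. It repeats no other entry because all elements of \<open>D\<close>
    exceed 1.\<close>
  define h where "h = g(N := 1)"
  define \<theta> where "\<theta> i = 1 / sqrt (real (h i))" for i
  have gD: "g i \<in> D" if "i < N" for i
    using g that by (auto simp: bij_betw_def)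
  have g1: "g i \<noteq> 1" if "i < N" for i
    using D[OF gD[OF that]] by simp
  have h: "squarefree (h i)" if "i \<le> N" for i
    using that gD[of i] D by (auto simp: h_def)
  have "inj_on h {..N}"
  proof -
    have "inj_on h (insert N {..<N})"
      using g g1 by (auto simp: h_def inj_on_def bij_betw_def dest: sym)
    then show ?thesis by (simp add: lessThan_Suc flip: lessThan_Suc_atMost)
  qed
  then have inj: "inj_on \<theta> {..N}"
    by (auto simp: inj_on_def \<theta>_def)
  have "\<theta> ` {..N} = (\<lambda>d. 1 / sqrt (real d)) ` h ` {..N}"
    by (auto simp: \<theta>_def image_image)
  then have ind: "module.independent (\<lambda>r x. of_int r * x) (\<theta> ` {..N})"
    using h by (auto intro!: independent_inverse_sqrt)
  have \<theta>pos: "\<theta> i > 0" if "i < N" for i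
    using gD[OF that] D that by (fastforce simp: \<theta>_def h_def)
  have "N > 0" using assms by (simp add: N_def card_gt_0_iff)
  \<comment> \<open>A tolerance of at most half the length of each interval keeps \<open>m\<close>
    strictly inside, since the approximation aims at the midpoint.\<close>
  define \<epsilon> where "\<epsilon> = Min ((\<lambda>i. \<theta> i / 2) ` {..<N})"
  have \<epsilon>: "\<epsilon> > 0" "\<And>i. i < N \<Longrightarrow> \<epsilon> \<le> \<theta> i / 2"
  proof -
    have "finite ((\<lambda>i. \<theta> i / 2) ` {..<N})" "(\<lambda>i. \<theta> i / 2) ` {..<N} \<noteq> {}"
      using \<open>N > 0\<close> by auto
    from Min_gr_iff[OF this, of 0] show "\<epsilon> > 0"
      using \<theta>pos by (auto simp: \<epsilon>_def)
    show "\<epsilon> \<le> \<theta> i / 2" if "i < N" for i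
      unfolding \<epsilon>_def using that by (intro Min_le) auto
  qed
  have "\<theta> N = 1" by (simp add: \<theta>_def h_def)
  then obtain k m where km: "\<And>i. i < N \<Longrightarrow> \<bar>of_int k * \<theta> i - of_int (m i) - (- \<theta> i / 2)\<bar> < \<epsilon>"
    using Kronecker_thm_2[OF ind inj _ \<epsilon>(1), of "\<lambda>i. - \<theta> i / 2"] by blast
  have "\<exists>m::int. k < m * sqrt (real d) \<and> m * sqrt (real d) < real_of_int k + 1" if d: "d \<in> D" for d
  proof -
    obtain i where i: "i < N" "d = g i"
      using g d by (auto simp: bij_betw_def)
    define s where "s = sqrt (real d)"
    have s: "s > 0" using D[OF d] by (simp add: s_def)
    have \<theta>: "\<theta> i = 1 / s" using i by (simp add: \<theta>_def h_def s_def)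
    have "k / s < m i" "m i < k / s + 1 / s"
      using km[OF i(1)] \<epsilon>(2)[OF i(1)] by (auto simp: \<theta>)
    then have "k < m i * s" "m i * s < real_of_int k + 1"
      using s by (auto simp: field_simps)
    then show ?thesis unfolding s_def by blast
  qed
  then show ?thesis by blast
qed

text \<open>Squares the bounds of the previous lemma, after arranging that the integer
  \<open>k\<close> yields a positive \<open>n\<close>.\<close>

lemma ex_common_gap_squares:
  fixes D :: "nat set"
  assumes "finite D" and D: "\<And>d. d \<in> D \<Longrightarrow> squarefree d \<and> d > 1"
  shows "\<exists>n::nat. n \<ge> 1 \<and> (\<forall>d\<in>D. \<exists>m::nat. m \<ge> 1 \<and> n\<^sup>2 < d * m\<^sup>2 \<and> d * m\<^sup>2 < (n + 1)\<^sup>2)"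
proof (cases "D = {}")
  case False
  obtain k :: int where k: "\<And>d. d \<in> D \<Longrightarrow> \<exists>m::int. k < m * sqrt (real d) \<and> m * sqrt (real d) < real_of_int k + 1"
    using ex_common_floor_multiple_sqrt[OF assms(1) False D] by blast
  have squares: "m \<ge> 1 \<and> n\<^sup>2 < d * m\<^sup>2 \<and> d * m\<^sup>2 < (n + 1)\<^sup>2"
    if "real n < real m * sqrt (real d)" "real m * sqrt (real d) < real n + 1" for m n d :: nat
  proof -
    have "(real n)\<^sup>2 < (real m * sqrt (real d))\<^sup>2" "(real m * sqrt (real d))\<^sup>2 < (real n + 1)\<^sup>2"
      using that by (intro power_strict_mono; simp)+
    then have "real (n\<^sup>2) < real (d * m\<^sup>2)" "real (d * m\<^sup>2) < real ((n + 1)\<^sup>2)"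
      by (simp_all add: power_mult_distrib mult_ac add_ac)
    moreover have "m \<noteq> 0" using that by (intro notI) simp
    ultimately show ?thesis by (simp only: of_nat_less_iff) simp
  qed
  have s1: "sqrt (real d) > 1" if "d \<in> D" for d using D[OF that] by simp
  \<comment> \<open>As \<open>sqrt d > 1\<close>, its nonzero integer multiples have absolute value
    at least 1, so neither \<open>(-1, 0)\<close> nor \<open>(0, 1)\<close> contains any
    multiple.\<close>
  have "k \<noteq> 0 \<and> k \<noteq> -1"
  proof -
    obtain d where d: "d \<in> D" using False by blast
    obtain m :: int where m: "k < m * sqrt (real d)" "m * sqrt (real d) < real_of_int k + 1" using k[OF d] by blast
    have "\<bar>m * sqrt (real d)\<bar> \<ge> 1 \<or> m = 0"
    proof (cases "m = 0")
      case False
      then have "1 * 1 \<le> \<bar>real_of_int m\<bar> * sqrt (real d)"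
        using s1[OF d] by (intro mult_mono) linarith+
      then show ?thesis by (simp add: abs_mult)
    qed simp
    then show ?thesis using m by auto
  qed
  then consider "k \<ge> 1" | "k \<le> -2" by linarith
  then show ?thesis
  proof cases
    case 1
    have "\<exists>m::nat. m \<ge> 1 \<and> (nat k)\<^sup>2 < d * m\<^sup>2 \<and> d * m\<^sup>2 < (nat k + 1)\<^sup>2" if d: "d \<in> D" for d
    proof -
      obtain m :: int where m: "k < m * sqrt (real d)" "m * sqrt (real d) < real_of_int k + 1" using k[OF d] by blast
      have "0 < m * sqrt (real d)" using m 1 by linarith
      then have "m > 0" using s1[OF d] by (simp add: zero_less_mult_iff)
      then show ?thesis using squares[of "nat k" "nat m" d] m 1 by auto
    qed
    then show ?thesis using 1 by (intro exI[of _ "nat k"]) auto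
  next
    case 2
    \<comment> \<open>Kronecker's theorem does not control the sign of \<open>k\<close>; negating \<open>m\<close> exchanges the open
      intervals \<open>(k, k + 1)\<close> and \<open>(-k - 1, -k)\<close>.\<close>
    define n where "n = nat (- k - 1)"
    have n: "real n = - real_of_int k - 1" "n \<ge> 1" using 2 by (auto simp: n_def)
    have "\<exists>m::nat. m \<ge> 1 \<and> n\<^sup>2 < d * m\<^sup>2 \<and> d * m\<^sup>2 < (n + 1)\<^sup>2" if d: "d \<in> D" for d
    proof -
      obtain m :: int where m: "k < m * sqrt (real d)" "m * sqrt (real d) < real_of_int k + 1" using k[OF d] by blast
      have "m * sqrt (real d) < 0" using m 2 by linarith
      then have "m < 0" using s1[OF d] by (simp add: mult_less_0_iff)
      then show ?thesis using squares[of n "nat (- m)" d] m n by auto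
    qed
    then show ?thesis using n by blast
  qed
qed auto

section \<open>Imaginary quadratic fields\<close>

lemma complex_ring_simps [simp]:
  "carrier complex_ring = UNIV" "x \<otimes>\<^bsub>complex_ring\<^esub> y = x * y" "x \<oplus>\<^bsub>complex_ring\<^esub> y = x + y"
  "\<one>\<^bsub>complex_ring\<^esub> = 1" "\<zero>\<^bsub>complex_ring\<^esub> = 0"
  by (simp_all add: ring_of_type_algebra_def)

lemma complex_ring_a_inv [simp]: "\<ominus>\<^bsub>complex_ring\<^esub> x = - x"
proof -
  interpret complex_ring: field complex_ring by (rule field_from_type_algebra)
  show ?thesis by (rule complex_ring.minus_equality) auto
qed

lemma complex_ring_m_inv [simp]:
  assumes "x \<noteq> 0"
  shows "inv\<^bsub>complex_ring\<^esub> x = inverse x"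
proof -
  interpret complex_ring: field complex_ring by (rule field_from_type_algebra)
  show ?thesis using assms by (intro complex_ring.comm_inv_char) auto
qed

lemma complex_subfieldD:
  assumes "subfield K complex_ring"
  shows "x \<in> K \<Longrightarrow> y \<in> K \<Longrightarrow> x + y \<in> K"
    and "x \<in> K \<Longrightarrow> - x \<in> K"
    and "x \<in> K \<Longrightarrow> y \<in> K \<Longrightarrow> x - y \<in> K"
    and "x \<in> K \<Longrightarrow> y \<in> K \<Longrightarrow> x * y \<in> K"
    and "x \<in> K \<Longrightarrow> y \<in> K \<Longrightarrow> x / y \<in> K"
    and "x \<in> \<rat> \<Longrightarrow> x \<in> K"
proof -
  interpret complex_ring: field complex_ring by (rule field_from_type_algebra)
  note sub = subringE[OF subfieldE(1)[OF assms], simplified]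
  show add: "x \<in> K \<Longrightarrow> y \<in> K \<Longrightarrow> x + y \<in> K" for x y by (rule sub)
  show minus: "x \<in> K \<Longrightarrow> - x \<in> K" for x using sub(5)[of x] by simp
  show "x \<in> K \<Longrightarrow> y \<in> K \<Longrightarrow> x - y \<in> K" using add[of x "- y"] minus[of y] by simp
  show mult: "x \<in> K \<Longrightarrow> y \<in> K \<Longrightarrow> x * y \<in> K" for x y by (rule sub)
  have inv: "inverse x \<in> K" if "x \<in> K" for x
    using that complex_ring.subfield_m_inv(1)[OF assms, of x] by (cases "x = 0") auto
  show div: "x \<in> K \<Longrightarrow> y \<in> K \<Longrightarrow> x / y \<in> K" for x y
    using mult[of x "inverse y"] inv[of y] by (simp add: divide_inverse)
  have nat: "of_nat n \<in> K" for n
    by (induction n) (auto intro: sub add)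
  have int: "of_int n \<in> K" for n
    by (cases n rule: int_cases2) (auto intro: nat minus)
  show "x \<in> \<rat> \<Longrightarrow> x \<in> K"
    by (elim Rats_cases') (auto intro: div int)
qed

section \<open>Rational bases in dimension two\<close>

lemma dimension_2_Rats:
  assumes "ring.dimension complex_ring 2 \<rat> K"
  obtains u v where "K = {a * u + b * v | a b. a \<in> \<rat> \<and> b \<in> \<rat>}"
proof -
  interpret complex_ring: field complex_ring by (rule field_from_type_algebra)
  have "complex_ring.dimension (Suc (Suc 0)) \<rat> K"
    using assms by (simp add: numeral_2_eq_2)
  then obtain u E where E: "K = complex_ring.line_extension \<rat> u E" "complex_ring.dimension (Suc 0) \<rat> E"
    by (cases rule: complex_ring.dimension.cases) auto
  have zero: "E' = {0}" if "complex_ring.dimension 0 \<rat> E'" for E'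
    using that by (cases rule: complex_ring.dimension.cases) auto
  from E(2) obtain v where v: "E = complex_ring.line_extension \<rat> v {0}"
    by (cases rule: complex_ring.dimension.cases) (auto dest: zero)
  have "z \<in> E \<longleftrightarrow> (\<exists>b\<in>\<rat>. z = b * v)" for z
    unfolding v complex_ring.line_extension_mem_iff by simp
  then have "x \<in> K \<longleftrightarrow> (\<exists>a\<in>\<rat>. \<exists>b\<in>\<rat>. x = a * u + b * v)" for x
    unfolding E(1) complex_ring.line_extension_mem_iff complex_ring_simps by metis
  then have "K = {a * u + b * v | a b. a \<in> \<rat> \<and> b \<in> \<rat>}" by blast
  then show ?thesis by (rule that)
qed

text \<open>Cramer's rule: write 1 and \<open>\<alpha>\<close> in terms of a spanning pair
  \<open>u\<close>, \<open>v\<close> and invert the coefficient matrix, whose determinant is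
  \<open>\<Delta>\<close>.\<close>

lemma dimension_2_basis:
  assumes "ring.dimension complex_ring 2 \<rat> K" "1 \<in> K" "\<alpha> \<in> K" "\<alpha> \<notin> \<rat>" "x \<in> K"
  obtains r s where "r \<in> \<rat>" "s \<in> \<rat>" "x = r + s * \<alpha>"
proof -
  obtain u v where K: "K = {a * u + b * v | a b. a \<in> \<rat> \<and> b \<in> \<rat>}"
    using dimension_2_Rats[OF assms(1)] .
  obtain a b where ab: "a \<in> \<rat>" "b \<in> \<rat>" "1 = a * u + b * v" using assms(2) K by auto
  obtain c d where cd: "c \<in> \<rat>" "d \<in> \<rat>" "\<alpha> = c * u + d * v" using assms(3) K by auto
  obtain e f where ef: "e \<in> \<rat>" "f \<in> \<rat>" "x = e * u + f * v" using assms(5) K by auto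
  define \<Delta> where "\<Delta> = a * d - b * c"
  have u: "\<Delta> * u = d - b * \<alpha>"
  proof -
    have "\<Delta> * u = d * (a * u + b * v) - b * (c * u + d * v)"
      by (simp add: \<Delta>_def algebra_simps)
    then show ?thesis by (simp flip: ab(3) cd(3))
  qed
  have v: "\<Delta> * v = a * \<alpha> - c"
  proof -
    have "\<Delta> * v = a * (c * u + d * v) - c * (a * u + b * v)"
      by (simp add: \<Delta>_def algebra_simps)
    then show ?thesis by (simp flip: ab(3) cd(3))
  qed
  \<comment> \<open>If \<open>\<Delta> = 0\<close>, then \<open>b * \<alpha> = d\<close> and
    \<open>a * \<alpha> = c\<close>. As \<open>\<alpha>\<close> is irrational,
    \<open>a = b = 0\<close>, contradicting \<open>1 = a * u + b * v\<close>.\<close>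
  have "\<Delta> \<noteq> 0"
  proof
    assume "\<Delta> = 0"
    then have eqs: "b * \<alpha> = d" "a * \<alpha> = c" using u v by auto
    have "b = 0"
    proof (rule ccontr)
      assume "b \<noteq> 0"
      then have "\<alpha> = d / b" using eqs by (auto simp: field_simps)
      then show False using assms(4) ab cd by auto
    qed
    moreover have "a = 0"
    proof (rule ccontr)
      assume "a \<noteq> 0"
      then have "\<alpha> = c / a" using eqs by (auto simp: field_simps)
      then show False using assms(4) ab cd by auto
    qed
    ultimately show False using ab(3) by simp
  qed
  have "\<Delta> * x = e * (\<Delta> * u) + f * (\<Delta> * v)" by (simp add: ef algebra_simps)
  also have "\<dots> = (e * d - f * c) + (f * a - e * b) * \<alpha>" unfolding u v by (simp add: algebra_simps)
  finally have "x = (e * d - f * c) / \<Delta> + (f * a - e * b) / \<Delta> * \<alpha>"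
    using \<open>\<Delta> \<noteq> 0\<close> by (simp add: field_simps)
  moreover have "(e * d - f * c) / \<Delta> \<in> \<rat>" "(f * a - e * b) / \<Delta> \<in> \<rat>"
    unfolding \<Delta>_def using ab cd ef by auto
  ultimately show ?thesis using that by blast
qed

section \<open>Square roots generating imaginary quadratic fields\<close>

lemma sqrt_neg_mult_square: "sqrt_neg (c * (int m)\<^sup>2) = of_nat m * sqrt_neg c"
  by (simp add: sqrt_neg_def real_sqrt_mult)

lemma Rats_imp_Reals: "x \<in> \<rat> \<Longrightarrow> x \<in> (\<real> :: complex set)"
  by (elim Rats_cases') auto

text \<open>Completing the square in the quadratic equation of a nonreal element gives a nonreal
  \<open>\<beta>\<close> with rational square. Such a \<open>\<beta>\<close> is purely imaginary,
  and extracting the square part of its cleared radicand leaves a squarefree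
  \<open>d\<close>.\<close>

lemma imaginary_quadratic_field_sqrt_neg:
  assumes "imaginary_quadratic_field K"
  shows "\<exists>d::nat. squarefree d \<and> K = {a + b * sqrt_neg (int d) | a b. a \<in> \<rat> \<and> b \<in> \<rat>}"
proof -
  have K: "subfield K complex_ring" "ring.dimension complex_ring 2 \<rat> K" "\<not> K \<subseteq> \<real>"
    using assms by (auto simp: imaginary_quadratic_field_def)
  note KD = complex_subfieldD[OF K(1)]
  obtain \<alpha> where \<alpha>: "\<alpha> \<in> K" "\<alpha> \<notin> \<real>" using K(3) by blast
  then have \<alpha>Q: "\<alpha> \<notin> \<rat>" using Rats_imp_Reals by blast
  note basis = dimension_2_basis[OF K(2) KD(6)[OF Rats_1] \<alpha>(1) \<alpha>Q]
  obtain r s where rs: "r \<in> \<rat>" "s \<in> \<rat>" "\<alpha> * \<alpha> = r + s * \<alpha>"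
    using basis[OF KD(4)[OF \<alpha>(1) \<alpha>(1)]] .
  define \<beta> where "\<beta> = \<alpha> - s / 2"
  have "\<beta> * \<beta> = \<alpha> * \<alpha> - s * \<alpha> + s * s / 4"
    by (simp add: \<beta>_def field_simps)
  then have "\<beta> * \<beta> = r + s * s / 4"
    by (simp add: rs(3))
  moreover have "r + s * s / 4 \<in> \<rat>" using rs by auto
  ultimately have "\<beta> * \<beta> \<in> \<rat>" by simp
  then obtain z :: int and w :: int where zw: "w > 0" "\<beta> * \<beta> = of_int z / of_int w"
    by (elim Rats_cases') auto
  have \<beta>: "\<beta> \<notin> \<real>"
  proof
    assume "\<beta> \<in> \<real>"
    then have "\<beta> + s / 2 \<in> \<real>" using Rats_imp_Reals[OF rs(2)] by auto
    then show False using \<alpha>(2) by (simp add: \<beta>_def)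
  qed
  have "\<beta> * \<beta> = of_real (of_int z / of_int w)" using zw(2) by simp
  then have "Re (\<beta> * \<beta>) = of_int z / of_int w" "Im (\<beta> * \<beta>) = 0"
    by (simp_all only: Re_complex_of_real Im_complex_of_real)
  \<comment> \<open>The imaginary part of the square is twice
    \<open>Re \<beta> * Im \<beta>\<close>. As \<open>\<beta>\<close> is not real, the real part
    must vanish.\<close>
  then have re_im: "Re \<beta> * Re \<beta> - Im \<beta> * Im \<beta> = of_int z / of_int w" "Re \<beta> = 0 \<or> Im \<beta> = 0"
    by auto
  define y where "y = Im \<beta>"
  have y0: "y \<noteq> 0" using \<beta> by (simp add: y_def complex_is_Real_iff)
  then have \<beta>y: "\<beta> = of_real y * \<i>" using re_im(2) by (auto simp: y_def complex_eq_iff)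
  have y2: "y * y = - (of_int z / of_int w)" using re_im(1) \<beta>y by auto
  have "(of_int w * y)\<^sup>2 = of_int w * of_int w * (y * y)"
    by (simp add: power2_eq_square)
  then have wy: "(of_int w * y)\<^sup>2 = of_int (- z * w)"
    using zw(1) unfolding y2 by simp
  \<comment> \<open>Multiplying \<open>y\<close> by the denominator \<open>w\<close> makes its
    square the natural number \<open>N\<close>.\<close>
  define N where "N = nat (- z * w)"
  have "0 \<le> - z * w"
    using wy by (metis of_int_0_le_iff zero_le_power2)
  then have N: "real N = (of_int w * y)\<^sup>2"
    unfolding wy N_def by (rule of_nat_nat)
  define d where "d = squarefree_part N"
  define t where "t = square_part N"
  have "N = d * t\<^sup>2" unfolding d_def t_def by (rule squarefree_decompose)
  then have "sqrt (real N) = real t * sqrt (real d)"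
    by (simp add: real_sqrt_mult)
  then have "of_int w * \<bar>y\<bar> = real t * sqrt (real d)"
    using zw(1) by (simp add: N abs_mult)
  define e0 where "e0 = real t / of_int w"
  have "\<bar>y\<bar> = e0 * sqrt (real d)"
    using zw(1) \<open>of_int w * \<bar>y\<bar> = real t * sqrt (real d)\<close> by (simp add: e0_def field_simps)
  \<comment> \<open>The root determines \<open>y\<close> only up to sign; the sign is absorbed into
    the rational factor \<open>e\<close>.\<close>
  then have "y = e0 * sqrt (real d) \<or> y = (- e0) * sqrt (real d)"
    by (simp only: mult_minus_left) linarith
  moreover have "e0 \<in> \<rat>" "- e0 \<in> \<rat>"
    by (auto simp: e0_def)
  ultimately obtain e :: real where e: "e \<in> \<rat>" "y = e * sqrt (real d)"
    by blast
  define q where "q = complex_of_real e"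
  have q: "q \<in> \<rat>" using e(1) by (elim Rats_cases') (auto simp: q_def)
  have \<alpha>eq: "\<alpha> = s / 2 + q * sqrt_neg (int d)"
    using \<beta>y e(2) by (simp add: \<beta>_def q_def sqrt_neg_def algebra_simps)
  have "q \<noteq> 0" using e(2) y0 by (auto simp: q_def)
  have "sqrt_neg (int d) = (\<alpha> - s / 2) / q" using \<open>q \<noteq> 0\<close> by (simp add: \<alpha>eq)
  moreover have "(\<alpha> - s / 2) / q \<in> K"
    using rs q by (intro KD(3,5) \<alpha> KD(6)) auto
  ultimately have dK: "sqrt_neg (int d) \<in> K" by simp
  have "x \<in> {a + b * sqrt_neg (int d) | a b. a \<in> \<rat> \<and> b \<in> \<rat>}" if x: "x \<in> K" for x
  proof -
    obtain a b where ab: "a \<in> \<rat>" "b \<in> \<rat>" "x = a + b * \<alpha>" using basis[OF x] .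
    then have "x = (a + b * s / 2) + (b * q) * sqrt_neg (int d)" by (simp add: \<alpha>eq algebra_simps)
    moreover have "a + b * s / 2 \<in> \<rat>" "b * q \<in> \<rat>" using ab q rs by auto
    ultimately show ?thesis by blast
  qed
  moreover have "a + b * sqrt_neg (int d) \<in> K" if "a \<in> \<rat>" "b \<in> \<rat>" for a b
    by (intro KD(1,4) KD(6)[OF that(1)] KD(6)[OF that(2)] dK)
  ultimately have "K = {a + b * sqrt_neg (int d) | a b. a \<in> \<rat> \<and> b \<in> \<rat>}" by blast
  moreover have "squarefree d" by (simp add: d_def)
  ultimately show ?thesis by (intro exI conjI)
qed

text \<open>The new generator is \<open>m\<close> times the old one, and \<open>m\<close> is
  invertible in the rationals. This leaves \<open>m\<close> free for placing the radicand in the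
  required range.\<close>

lemma rat_adjoin_sqrt_neg_multiple:
  assumes K: "subfield K complex_ring" "K = {a + b * sqrt_neg c | a b. a \<in> \<rat> \<and> b \<in> \<rat>}"
    and "m \<ge> 1"
  shows "sqrt_neg (c * (int m)\<^sup>2) \<in> K" "rat_adjoin (sqrt_neg (c * (int m)\<^sup>2)) = K"
proof -
  interpret complex_ring: field complex_ring by (rule field_from_type_algebra)
  let ?\<gamma> = "sqrt_neg (c * (int m)\<^sup>2)"
  have "?\<gamma> = 0 + of_nat m * sqrt_neg c" by (simp add: sqrt_neg_mult_square)
  moreover have "0 \<in> \<rat>" "of_nat m \<in> \<rat>" by auto
  ultimately show \<gamma>: "?\<gamma> \<in> K" unfolding K(2) by blast
  have "rat_adjoin ?\<gamma> \<subseteq> K"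
    unfolding rat_adjoin_def
    using K(1) \<gamma> complex_subfieldD(6)[OF K(1)]
    by (intro complex_ring.generate_field_min_subfield1) auto
  moreover have "K \<subseteq> rat_adjoin ?\<gamma>"
  proof
    have sub: "subfield (rat_adjoin ?\<gamma>) complex_ring"
      unfolding rat_adjoin_def by (rule complex_ring.generate_field_is_subfield) simp
    note LD = complex_subfieldD[OF sub]
    have \<gamma>L: "?\<gamma> \<in> rat_adjoin ?\<gamma>"
      unfolding rat_adjoin_def by (rule generate_field.incl) simp
    fix x assume "x \<in> K"
    then obtain a b where ab: "a \<in> \<rat>" "b \<in> \<rat>" "x = a + b * sqrt_neg c" unfolding K(2) by blast
    then have "x = a + b / of_nat m * ?\<gamma>" using assms(3) by (simp add: sqrt_neg_mult_square)
    also have "\<dots> \<in> rat_adjoin ?\<gamma>"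
      using ab by (intro LD(1,4) \<gamma>L LD(6)) auto
    finally show "x \<in> rat_adjoin ?\<gamma>" .
  qed
  ultimately show "rat_adjoin ?\<gamma> = K" by blast
qed

theorem theorem9:
  fixes k :: nat and K :: "nat \<Rightarrow> complex set"
  assumes "k \<ge> 1"
    and "inj_on K {1..k}"
    and "\<And>i. i \<in> {1..k} \<Longrightarrow> imaginary_quadratic_field (K i)"
    and "\<And>i. i \<in> {1..k} \<Longrightarrow> K i \<noteq> rat_adjoin \<i>"
  shows "\<exists>n::nat. n \<ge> 1 \<and> (\<forall>i\<in>{1..k}. \<exists>\<alpha>\<in>I2i (2 * n). primitive_element \<alpha> (K i))"
proof -
  have "\<forall>i\<in>{1..k}. \<exists>d::nat. squarefree d \<and>
      K i = {a + b * sqrt_neg (int d) | a b. a \<in> \<rat> \<and> b \<in> \<rat>}"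
    by (intro ballI imaginary_quadratic_field_sqrt_neg assms(3))
  from bchoice[OF this] obtain d :: "nat \<Rightarrow> nat" where dK: "\<forall>i\<in>{1..k}. squarefree (d i) \<and>
      K i = {a + b * sqrt_neg (int (d i)) | a b. a \<in> \<rat> \<and> b \<in> \<rat>}" ..
  note d = dK[rule_format, THEN conjunct1] and K = dK[rule_format, THEN conjunct2]
  have sub: "subfield (K i) complex_ring" if "i \<in> {1..k}" for i
    using assms(3)[OF that] by (simp add: imaginary_quadratic_field_def)
  have "d i > 1" if i: "i \<in> {1..k}" for i
  proof -
    have "d i \<noteq> 0" using d[OF i] by (metis not_squarefree_0)
    moreover have "d i \<noteq> 1"
    proof
      assume "d i = 1"
      then have "rat_adjoin \<i> = K i"
        using rat_adjoin_sqrt_neg_multiple(2)[OF sub[OF i] K[OF i], of 1] by (simp add: sqrt_neg_def)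
      then show False using assms(4)[OF i] by simp
    qed
    ultimately show ?thesis by simp
  qed
  then obtain n :: nat where n: "n \<ge> 1"
    and "\<forall>e\<in>d ` {1..k}. \<exists>m::nat. m \<ge> 1 \<and> n\<^sup>2 < e * m\<^sup>2 \<and> e * m\<^sup>2 < (n + 1)\<^sup>2"
    using ex_common_gap_squares[of "d ` {1..k}"] d by blast
  then have m: "\<exists>m::nat. m \<ge> 1 \<and> n\<^sup>2 < d i * m\<^sup>2 \<and> d i * m\<^sup>2 < (n + 1)\<^sup>2" if "i \<in> {1..k}" for i
    using that by blast
  have "\<exists>\<alpha>\<in>I2i (2 * n). primitive_element \<alpha> (K i)" if i: "i \<in> {1..k}" for i
  proof -
    obtain m :: nat where m: "m \<ge> 1" "n\<^sup>2 < d i * m\<^sup>2" "d i * m\<^sup>2 < (n + 1)\<^sup>2" using m[OF i] by blast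
    \<comment> \<open>The square factor changes the generator only by the factor \<open>m\<close>
      and puts \<open>c\<close> between the two consecutive squares.\<close>
    define c where "c = int (d i) * (int m)\<^sup>2"
    have c: "real_of_int c = real (d i * m\<^sup>2)" by (simp add: c_def)
    have "primitive_element (sqrt_neg c) (K i)"
      using rat_adjoin_sqrt_neg_multiple[OF sub[OF i] K[OF i] m(1)]
      by (simp add: primitive_element_def c_def)
    moreover have n_less: "(real n)\<^sup>2 < of_int c" and less_n: "of_int c < (real n + 1)\<^sup>2"
    proof -
      have "real (n\<^sup>2) < real (d i * m\<^sup>2)" "real (d i * m\<^sup>2) < real ((n + 1)\<^sup>2)"
        using m(2,3) by (simp_all only: of_nat_less_iff)
      then show "(real n)\<^sup>2 < of_int c" "of_int c < (real n + 1)\<^sup>2"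
        unfolding c by (simp_all only: of_nat_power of_nat_add of_nat_1)
    qed
    moreover have "sqrt_neg c \<notin> \<real>"
    proof -
      have "0 \<le> (real n)\<^sup>2" by simp
      then have "c > 0" using n_less by linarith
      then show ?thesis by (simp add: sqrt_neg_def complex_is_Real_iff)
    qed
    \<comment> \<open>Half of the index \<open>2 * n\<close> is \<open>n\<close>, so the bounds in
      \<open>I2i\<close> are exactly the squares of \<open>n\<close> and
      \<open>n + 1\<close>.\<close>
    ultimately show ?thesis by (intro bexI[of _ "sqrt_neg c"]) (auto simp: I2i_def)
  qed
  then show ?thesis using n by blast
qed

end
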